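(* Let $d\ge 1$ and $S=\mathbb{Z}^d$. Let $A\subset S$ and $B=S\setminus A$, with $A$ and $B$ both nonempty. Then the following three conditions on the pair $(A,B)$ are equivalent: Condition H (separation by a sequence of affine hyperplanes), Condition R (ray condition), and Condition P (parallelogram condition).
   Context: Let $A,B\subset\mathbb{Z}^d$ be nonempty disjoint sets and $S=A\cup B$. Separation in an affine subspace. Let $L\subset\mathbb{R}^d$ be an affine subspace of dimension $l$. A hyperplane in $L$ is an affine subspace $P\subset L$ of dimension $l-1$. $P$ separates $A$ and $B$ in $L$ if there exist two disjoint connected components $R^+$ and $R^-$ of $L\setminus P$ such that $R^+\cup R^-=L\setminus P$, $R^+\cap S\subset A$ and $R^-\cap S\subset B$. (Points of both $A$ and $B$ are allowed on $P$; hyperplanes may have irrational coefficients.) Condition H. There exist $k$ with $0\le k\le d$ and affine subspaces $H_k\subset H_{k+1}\subset\cdots\subset H_d=\mathbb{R}^d$ with $\dim H_i=i$ such that (1) $H_k\cap S\subset A$ or $H_k\cap S\subset B$, and (2) for every $i$ with $k+1\le i\le d$, $H_{i-1}$ separates $A$ and $B$ in $H_i$. Condition R. For each line $L\subset\mathbb{R}^d$ such that $A\cap L\ne\emptyset$ and $B\cap L\ne\emptyset$, there exists a ray (half-line) $L'\subset L$ such that $A\cap L=L'\cap S$. Condition P (the 2-parallelogram condition). For $k'\in\{1,2\}$, all $a_1,\dots,a_{k'}\in A$ and all $b_1,\dots,b_{k'}\in B$ (repetitions allowed), $\sum_{i=1}^{k'}a_i\ne\sum_{i=1}^{k'}b_i$.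 *)

theory Defs
  imports "HOL-Analysis.Analysis"
begin

definition int_lattice :: "(real ^ 'n) set" where
  "int_lattice = {x. \<forall>i. x $ i \<in> \<int>}"

definition hyperplane_in :: "(real ^ 'n) set \<Rightarrow> (real ^ 'n) set \<Rightarrow> bool" where
  "hyperplane_in P L \<longleftrightarrow> affine P \<and> P \<subseteq> L \<and> aff_dim P = aff_dim L - 1"

text \<open>In the following definitions the ambient point set \<open>S\<close> is \<open>A \<union> B\<close>.\<close>

definition separates_in ::
  "(real ^ 'n) set \<Rightarrow> (real ^ 'n) set \<Rightarrow> (real ^ 'n) set \<Rightarrow> (real ^ 'n) set \<Rightarrow> bool" where
  "separates_in P L A B \<longleftrightarrow>
     hyperplane_in P L \<and>
     (\<exists>Rp \<in> components (L - P). \<exists>Rm \<in> components (L - P).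
        Rp \<inter> Rm = {} \<and> Rp \<union> Rm = L - P \<and>
        Rp \<inter> (A \<union> B) \<subseteq> A \<and> Rm \<inter> (A \<union> B) \<subseteq> B)"

text \<open>Only the values \<open>H k, \<dots>, H d\<close> of the sequence are constrained, where
  \<open>d = CARD('n)\<close>.\<close>

definition condition_H :: "(real ^ 'n) set \<Rightarrow> (real ^ 'n) set \<Rightarrow> bool" where
  "condition_H A B \<longleftrightarrow>
     (\<exists>k \<le> CARD('n). \<exists>H :: nat \<Rightarrow> (real ^ 'n) set.
        (\<forall>i \<in> {k..CARD('n)}. affine (H i) \<and> aff_dim (H i) = int i) \<and>
        (\<forall>i \<in> {k+1..CARD('n)}. H (i - 1) \<subseteq> H i) \<and>
        H CARD('n) = UNIV \<and>
        (H k \<inter> (A \<union> B) \<subseteq> A \<or> H k \<inter> (A \<union> B) \<subseteq> B) \<and>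
        (\<forall>i \<in> {k+1..CARD('n)}. separates_in (H (i - 1)) (H i) A B))"

text \<open>Rays contain their endpoint. For subsets of the integer lattice, asking for
  an open ray in \<open>condition_R\<close> instead would make no difference, since the lattice
  is discrete.\<close>

definition is_ray :: "(real ^ 'n) set \<Rightarrow> bool" where
  "is_ray R \<longleftrightarrow> (\<exists>x v. v \<noteq> 0 \<and> R = {x + t *\<^sub>R v | t. t \<ge> 0})"

definition condition_R :: "(real ^ 'n) set \<Rightarrow> (real ^ 'n) set \<Rightarrow> bool" where
  "condition_R A B \<longleftrightarrow>
     (\<forall>L. affine L \<and> aff_dim L = 1 \<and> A \<inter> L \<noteq> {} \<and> B \<inter> L \<noteq> {} \<longrightarrow>
        (\<exists>L'. is_ray L' \<and> L' \<subseteq> L \<and> A \<inter> L = L' \<inter> (A \<union> B)))"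

definition condition_P :: "(real ^ 'n) set \<Rightarrow> (real ^ 'n) set \<Rightarrow> bool" where
  "condition_P A B \<longleftrightarrow>
     (\<forall>k \<in> {1, 2 :: nat}. \<forall>a b :: nat \<Rightarrow> real ^ 'n.
        (\<forall>i \<in> {1..k}. a i \<in> A) \<and> (\<forall>i \<in> {1..k}. b i \<in> B) \<longrightarrow>
        (\<Sum>i=1..k. a i) \<noteq> (\<Sum>i=1..k. b i))"

end

theory Submission
  imports Defs
begin

text \<open>
  H implies P: a relation \<open>a1 + a2 = b1 + b2\<close> forces all four points onto each separating
  hyperplane in turn, hence into the last subspace, which meets only one of the two sets.

  P implies H: since \<open>A\<close> and \<open>B\<close> partition the lattice, P excludes equal sums of any number
  of points. By simultaneous Dirichlet approximation, a common point of the two convex hulls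
  would give such equal sums, so the hulls are disjoint, and one separates them in the whole
  space, then again within the separating hyperplane, and so on.

  R and P: on a line, P says that the points of \<open>A\<close> form an initial or final segment of the
  arithmetic progression of lattice points. Conversely, R says that reflecting a point of one
  set in a point of the other stays in the latter, and three such reflections refute
  \<open>a1 + a2 = b1 + b2\<close>.
\<close>

subsection \<open>The parallelogram condition for lattice partitions\<close>

lemma condition_P_iff:
  fixes A B :: "(real ^ 'n) set"
  shows "condition_P A B \<longleftrightarrow>
    A \<inter> B = {} \<and> (\<forall>a1\<in>A. \<forall>a2\<in>A. \<forall>b1\<in>B. \<forall>b2\<in>B. a1 + a2 \<noteq> b1 + b2)"
    (is "?P \<longleftrightarrow> ?Q")
proof
  assume P: ?P
  have "a \<noteq> b" if "a \<in> A" "b \<in> B" for a b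
    using P[unfolded condition_P_def, rule_format, of 1 "\<lambda>_. a" "\<lambda>_. b"] that by auto
  moreover have "a1 + a2 \<noteq> b1 + b2" if "a1 \<in> A" "a2 \<in> A" "b1 \<in> B" "b2 \<in> B" for a1 a2 b1 b2
    using P[unfolded condition_P_def, rule_format, of 2
        "\<lambda>i. if i = 1 then a1 else a2" "\<lambda>i. if i = 1 then b1 else b2"] that
    by (auto simp: numeral_2_eq_2)
  ultimately show ?Q by blast
next
  assume Q: ?Q
  show ?P
    unfolding condition_P_def
  proof (intro ballI allI impI)
    fix k :: nat and a b :: "nat \<Rightarrow> real ^ 'n"
    assume k: "k \<in> {1, 2}" and ab: "(\<forall>i\<in>{1..k}. a i \<in> A) \<and> (\<forall>i\<in>{1..k}. b i \<in> B)"
    show "(\<Sum>i=1..k. a i) \<noteq> (\<Sum>i=1..k. b i)"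
    proof (cases "k = 1")
      case True
      then show ?thesis using ab Q by auto
    next
      case False
      then have "k = 2" using k by simp
      then show ?thesis using ab Q by (auto simp: numeral_2_eq_2)
    qed
  qed
qed

lemma int_lattice_add: "x \<in> int_lattice \<Longrightarrow> y \<in> int_lattice \<Longrightarrow> x + y \<in> int_lattice"
  and int_lattice_diff: "x \<in> int_lattice \<Longrightarrow> y \<in> int_lattice \<Longrightarrow> x - y \<in> int_lattice"
  and int_lattice_scaleR_int: "x \<in> int_lattice \<Longrightarrow> of_int n *\<^sub>R x \<in> int_lattice"
  by (auto simp: int_lattice_def)

text \<open>The point \<open>a1 + a2 - b\<close> completes a parallelogram and is again a lattice
  point. Were it in \<open>B\<close>, its sum with \<open>b\<close> would be a forbidden relation.
  It is essential here that \<open>A\<close> and \<open>B\<close> exhaust the lattice.\<close>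

lemma condition_P_add_diff:
  assumes "A \<union> B = int_lattice" "condition_P A B" "a1 \<in> A" "a2 \<in> A" "b \<in> B"
  shows "a1 + a2 - b \<in> A"
proof (rule ccontr)
  assume "a1 + a2 - b \<notin> A"
  moreover have "a1 + a2 - b \<in> A \<union> B"
    using assms int_lattice_add int_lattice_diff by (metis UnCI)
  ultimately have "a1 + a2 - b \<in> B" by blast
  moreover have "a1 + a2 = b + (a1 + a2 - b)" by simp
  ultimately show False using assms(2-5) unfolding condition_P_iff by blast
qed

text \<open>Replacing \<open>a1 + a2\<close> by \<open>b + (a1 + a2 - b)\<close> and cancelling \<open>b\<close> shortens a relation
  between sums, so the parallelogram condition propagates to sums of any length.\<close>

lemma sum_mset_neq_if_add_diff_closed:
  fixes A B :: "'a::ab_group_add set"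
  assumes "A \<inter> B = {}"
    and closed: "\<And>a1 a2 b. a1 \<in> A \<Longrightarrow> a2 \<in> A \<Longrightarrow> b \<in> B \<Longrightarrow> a1 + a2 - b \<in> A"
    and "set_mset M \<subseteq> A" "set_mset N \<subseteq> B" "size M = size N" "M \<noteq> {#}"
  shows "\<Sum>\<^sub># M \<noteq> \<Sum>\<^sub># N"
  using assms(3-6)
proof (induction "size M" arbitrary: M N rule: less_induct)
  case less
  from less.prems obtain a M' where M: "M = add_mset a M'" by (meson multiset_cases)
  with less.prems have "N \<noteq> {#}" by auto
  then obtain b N' where N: "N = add_mset b N'" by (meson multiset_cases)
  show ?case
  proof (cases "M' = {#}")
    case True
    with M N less.prems have "N' = {#}" by simp
    with True M N less.prems assms(1) show ?thesis by auto
  next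
    case False
    then obtain a' M'' where M': "M' = add_mset a' M''" by (meson multiset_cases)
    let ?c = "a + a' - b"
    have "\<Sum>\<^sub># (add_mset ?c M'') \<noteq> \<Sum>\<^sub># N'"
    proof (rule less.hyps)
      show "set_mset (add_mset ?c M'') \<subseteq> A"
        using less.prems M M' N closed[of a a' b] by auto
    qed (use less.prems M M' N in auto)
    then show ?thesis
      by (auto simp: M M' N algebra_simps)
  qed
qed

subsection \<open>Integer relations close to real relations\<close>

text \<open>Simultaneous Dirichlet approximation, transported from an initial segment of the
  naturals to a finite index set along an enumeration.\<close>

lemma Dirichlet_approx_finite_set:
  fixes \<theta> :: "'a \<Rightarrow> real"
  assumes "finite T" "N > 0"
  obtains q :: int and p :: "'a \<Rightarrow> int"
  where "q > 0" "\<And>x. x \<in> T \<Longrightarrow> \<bar>of_int q * \<theta> x - of_int (p x)\<bar> < 1 / real N"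
proof -
  obtain f where f: "bij_betw f T {..<card T}"
    using ex_bij_betw_finite_nat[OF assms(1)] by (auto simp: atLeast0LessThan)
  obtain q p where q: "0 < q"
    and p: "\<And>i. i < card T \<Longrightarrow>
      \<bar>of_int q * (\<theta> \<circ> inv_into T f) i - of_int (p i)\<bar> < 1 / real N"
    using Dirichlet_approx_simult[OF assms(2), of "card T" "\<theta> \<circ> inv_into T f"] by metis
  have "\<bar>of_int q * \<theta> x - of_int ((p \<circ> f) x)\<bar> < 1 / real N" if "x \<in> T" for x
  proof -
    have "f x < card T" "inv_into T f (f x) = x"
      using that f by (auto simp: bij_betw_def)
    with p[of "f x"] show ?thesis by simp
  qed
  then show ?thesis using that q by blast
qed

lemma abs_Ints_less_1_imp_0:
  fixes x :: real
  assumes "x \<in> \<int>" "\<bar>x\<bar> < 1"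
  shows "x = 0"
  using assms by (auto elim!: Ints_cases)

text \<open>With \<open>p\<close> close enough to \<open>q * w\<close>, every sum in the conclusion
  is, coordinatewise, an integer within distance less than 1 of \<open>q * 0\<close>. Hence it is
  exactly 0, although \<open>p\<close> is only an approximation.\<close>

lemma integer_relation_near_real_relation:
  fixes T :: "(real ^ 'n) set" and w :: "real ^ 'n \<Rightarrow> real"
  assumes "finite T" "T \<subseteq> int_lattice"
    and w: "(\<Sum>v\<in>T. w v) = 0" "(\<Sum>v\<in>T. w v *\<^sub>R v) = 0" and "\<epsilon> > 0"
  obtains q :: int and p :: "real ^ 'n \<Rightarrow> int"
  where "q > 0" "\<And>v. v \<in> T \<Longrightarrow> \<bar>of_int q * w v - of_int (p v)\<bar> < \<epsilon>"
    "(\<Sum>v\<in>T. p v) = 0" "(\<Sum>v\<in>T. of_int (p v) *\<^sub>R v) = 0"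
proof -
  \<comment> \<open>The first summand keeps the accumulated error of each sum below 1; the second
    makes \<open>1 / N\<close> smaller than \<open>\<epsilon>\<close>.\<close>
  define K where "K = (\<Sum>v\<in>T. 1 + norm v) + 1 / \<epsilon>"
  have K: "K > 0" unfolding K_def using \<open>\<epsilon> > 0\<close>
    by (intro add_nonneg_pos sum_nonneg) auto
  obtain N :: nat where N: "real N > K" using reals_Archimedean2 by blast
  then have N0: "N > 0" using K by (cases N) auto
  obtain q :: int and p :: "real ^ 'n \<Rightarrow> int" where q: "q > 0"
    and p: "\<And>v. v \<in> T \<Longrightarrow> \<bar>of_int q * w v - of_int (p v)\<bar> < 1 / real N"
    using Dirichlet_approx_finite_set[OF assms(1) N0] by metis
  \<comment> \<open>Serves both relations: \<open>c = 1\<close> for the sum of coefficients and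
    \<open>c v = v $ i\<close> for each coordinate. The bound \<open>1 + norm v\<close> covers both
    choices.\<close>
  have sum_0: "(\<Sum>v\<in>T. of_int (p v) * c v) = (0::real)"
    if c: "\<And>v. v \<in> T \<Longrightarrow> c v \<in> \<int>" "\<And>v. v \<in> T \<Longrightarrow> \<bar>c v\<bar> \<le> 1 + norm v"
      and wc: "(\<Sum>v\<in>T. w v * c v) = 0" for c
  proof (rule abs_Ints_less_1_imp_0)
    show "(\<Sum>v\<in>T. of_int (p v) * c v) \<in> \<int>"
      using c(1) by (intro Ints_sum Ints_mult) auto
    have "(\<Sum>v\<in>T. of_int (p v) * c v) = - (\<Sum>v\<in>T. (of_int q * w v - of_int (p v)) * c v)"
      using wc by (simp add: left_diff_distrib sum_subtractf mult.assoc flip: sum_distrib_left)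
    also have "\<bar>\<dots>\<bar> \<le> (\<Sum>v\<in>T. \<bar>of_int q * w v - of_int (p v)\<bar> * \<bar>c v\<bar>)"
      unfolding abs_minus_cancel abs_mult[symmetric] by (rule sum_abs)
    also have "\<dots> \<le> (\<Sum>v\<in>T. 1 / real N * (1 + norm v))"
      using p c(2) by (intro sum_mono mult_mono) (auto simp: less_imp_le)
    also have "\<dots> = (\<Sum>v\<in>T. 1 + norm v) / real N"
      by (simp add: sum_divide_distrib)
    also have "\<dots> < 1"
      using N N0 \<open>\<epsilon> > 0\<close> by (auto simp: K_def divide_less_eq intro: less_trans[rotated])
    finally show "\<bar>\<Sum>v\<in>T. of_int (p v) * c v\<bar> < 1" .
  qed
  show ?thesis
  proof (rule that[of q p])
    show "q > 0" by fact
    have "1 / \<epsilon> < real N"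
      using N sum_nonneg[of T "\<lambda>v. 1 + norm v"] by (simp add: K_def)
    then have "1 / real N < \<epsilon>" using N0 \<open>\<epsilon> > 0\<close> by (simp add: field_simps)
    then show "\<bar>of_int q * w v - of_int (p v)\<bar> < \<epsilon>" if "v \<in> T" for v
      using p[OF that] by linarith
    show "(\<Sum>v\<in>T. p v) = 0"
      using sum_0[of "\<lambda>_. 1"] w(1) by (simp flip: of_int_sum)
    show "(\<Sum>v\<in>T. of_int (p v) *\<^sub>R v) = 0"
    proof (subst vec_eq_iff, intro allI)
      fix i
      have "(\<Sum>v\<in>T. of_int (p v) * v $ i) = 0"
      proof (rule sum_0)
        show "v $ i \<in> \<int>" if "v \<in> T" for v
          using that assms(2) by (auto simp: int_lattice_def)
        show "\<bar>v $ i\<bar> \<le> 1 + norm v" for v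
          using component_le_norm_cart[of v i] by simp
        show "(\<Sum>v\<in>T. w v * v $ i) = 0"
          using arg_cong[OF w(2), of "\<lambda>x. x $ i"] by simp
      qed
      then show "(\<Sum>v\<in>T. of_int (p v) *\<^sub>R v) $ i = 0 $ i" by simp
    qed
  qed
qed

text \<open>Turns nonnegative integer coefficients into a multiset with these multiplicities, so
  that an integer relation can be read as an equality of multiset sums.\<close>

lemma
  fixes S :: "'a::real_vector set"
  assumes "finite S"
  shows set_mset_sum_replicate: "set_mset (\<Sum>v\<in>S. replicate_mset (n v) v) \<subseteq> S"
    and size_sum_replicate: "size (\<Sum>v\<in>S. replicate_mset (n v) v) = (\<Sum>v\<in>S. n v)"
    and sum_mset_sum_replicate:
      "\<Sum>\<^sub># (\<Sum>v\<in>S. replicate_mset (n v) v) = (\<Sum>v\<in>S. of_nat (n v) *\<^sub>R v)"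
proof -
  have "\<Sum>\<^sub># (replicate_mset m x) = of_nat m *\<^sub>R x" for m and x :: 'a
    by (induction m) (auto simp: algebra_simps)
  with assms show "set_mset (\<Sum>v\<in>S. replicate_mset (n v) v) \<subseteq> S"
    "size (\<Sum>v\<in>S. replicate_mset (n v) v) = (\<Sum>v\<in>S. n v)"
    "\<Sum>\<^sub># (\<Sum>v\<in>S. replicate_mset (n v) v) = (\<Sum>v\<in>S. of_nat (n v) *\<^sub>R v)"
    by (induction S) (auto split: if_splits simp del: sum_mset_replicate_mset)
qed

text \<open>A common point of the hulls is an affine relation with coefficients at least 0 on points
  of \<open>A\<close> and at most 0 on points of \<open>B\<close>. A nearby integer relation keeps
  these signs; moving the negative part to the other side gives two multisets of equal size and
  sum.\<close>

lemma convex_hulls_disjoint_if_sum_msets_differ: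
  fixes A B :: "(real ^ 'n) set"
  assumes "A \<subseteq> int_lattice" "B \<subseteq> int_lattice" "A \<inter> B = {}"
    and sums: "\<And>M N. set_mset M \<subseteq> A \<Longrightarrow> set_mset N \<subseteq> B \<Longrightarrow> size M = size N \<Longrightarrow>
      M \<noteq> {#} \<Longrightarrow> \<Sum>\<^sub># M \<noteq> \<Sum>\<^sub># N"
  shows "convex hull A \<inter> convex hull B = {}"
proof (rule ccontr)
  assume "convex hull A \<inter> convex hull B \<noteq> {}"
  then obtain y where "y \<in> convex hull A" "y \<in> convex hull B" by blast
  then obtain S u S' u' where S: "finite S" "S \<subseteq> A" "\<forall>x\<in>S. 0 \<le> u x" "sum u S = 1"
      "(\<Sum>v\<in>S. u v *\<^sub>R v) = y"
    and S': "finite S'" "S' \<subseteq> B" "\<forall>x\<in>S'. 0 \<le> u' x" "sum u' S' = 1"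
      "(\<Sum>v\<in>S'. u' v *\<^sub>R v) = y"
    unfolding convex_hull_explicit by blast
  have disj: "S \<inter> S' = {}" using S S' assms(3) by blast
  then have [simp]: "v \<notin> S" if "v \<in> S'" for v using that by blast
  define w where "w v = (if v \<in> S then u v else - u' v)" for v
  \<comment> \<open>This point will have positive multiplicity in \<open>M\<close>, which keeps the
    integer relation from being trivial.\<close>
  obtain v0 where v0: "v0 \<in> S" "u v0 > 0"
    using S by (metis less_eq_real_def sum.neutral zero_neq_one)
  have w_S: "(\<Sum>v\<in>S. w v) = 1" "(\<Sum>v\<in>S. w v *\<^sub>R v) = y"
    using S by (simp_all add: w_def)
  have w_S': "(\<Sum>v\<in>S'. w v) = - 1" "(\<Sum>v\<in>S'. w v *\<^sub>R v) = - y"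
    using S' by (simp_all add: w_def sum_negf)
  obtain q :: int and p :: "real ^ 'n \<Rightarrow> int" where "q > 0"
    \<comment> \<open>An error below 1 lets no integer \<open>p v\<close> take the wrong sign; an
      error below \<open>u v0\<close> keeps \<open>p v0\<close> positive, since \<open>q\<close> is
      at least 1.\<close>
    and p: "\<And>v. v \<in> S \<union> S' \<Longrightarrow> \<bar>of_int q * w v - of_int (p v)\<bar> < min 1 (u v0)"
    and sum_p: "(\<Sum>v\<in>S \<union> S'. p v) = 0" "(\<Sum>v\<in>S \<union> S'. of_int (p v) *\<^sub>R v) = 0"
  proof (rule integer_relation_near_real_relation[of "S \<union> S'" w "min 1 (u v0)"])
    show "(\<Sum>v\<in>S \<union> S'. w v) = 0" "(\<Sum>v\<in>S \<union> S'. w v *\<^sub>R v) = 0"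
      using w_S w_S' S(1) S'(1) disj by (simp_all add: sum.union_disjoint)
  qed (use S S' assms v0 in auto)
  have p_S: "p v \<ge> 0" if "v \<in> S" for v
  proof -
    have "real_of_int q * w v \<ge> 0" using \<open>q > 0\<close> S that by (simp add: w_def)
    then have "real_of_int (p v) > - 1" using p[of v] that by auto
    then show ?thesis by linarith
  qed
  have p_S': "p v \<le> 0" if "v \<in> S'" for v
  proof -
    have "real_of_int q * w v \<le> 0" using \<open>q > 0\<close> S' that by (simp add: w_def)
    then have "real_of_int (p v) < 1" using p[of v] that by auto
    then show ?thesis by linarith
  qed
  have "real_of_int q * u v0 \<ge> 1 * u v0"
    using \<open>q > 0\<close> v0 by (intro mult_right_mono) auto
  moreover have "\<bar>real_of_int q * u v0 - real_of_int (p v0)\<bar> < u v0"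
    using p[of v0] v0 by (simp add: w_def)
  ultimately have "real_of_int (p v0) > 0" by linarith
  then have p_v0: "p v0 > 0" by simp
  define M where "M = (\<Sum>v\<in>S. replicate_mset (nat (p v)) v)"
  define N where "N = (\<Sum>v\<in>S'. replicate_mset (nat (- p v)) v)"
  have "int (size M) = (\<Sum>v\<in>S. p v)"
    using p_S S(1) by (simp add: M_def size_sum_replicate)
  moreover have "int (size N) = - (\<Sum>v\<in>S'. p v)"
    using p_S' S'(1) by (simp add: N_def size_sum_replicate sum_negf)
  moreover have "(\<Sum>v\<in>S. p v) + (\<Sum>v\<in>S'. p v) = 0"
    using sum_p(1) S(1) S'(1) disj by (simp add: sum.union_disjoint)
  ultimately have size: "size M = size N" by linarith
  have "(\<Sum>v\<in>S. p v) \<ge> p v0"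
    using p_S v0 S(1) by (intro member_le_sum) auto
  with \<open>int (size M) = _\<close> p_v0 have "M \<noteq> {#}" by auto
  have "\<Sum>\<^sub># M = (\<Sum>v\<in>S. of_int (p v) *\<^sub>R v)"
    using p_S S(1) by (simp add: M_def sum_mset_sum_replicate)
  moreover have "\<Sum>\<^sub># N = - (\<Sum>v\<in>S'. of_int (p v) *\<^sub>R v)"
    using p_S' S'(1) by (simp add: N_def sum_mset_sum_replicate sum_negf)
  moreover have "(\<Sum>v\<in>S. of_int (p v) *\<^sub>R v) + (\<Sum>v\<in>S'. of_int (p v) *\<^sub>R v) = 0"
    using sum_p(2) S(1) S'(1) disj by (simp add: sum.union_disjoint)
  ultimately have "\<Sum>\<^sub># M = \<Sum>\<^sub># N" by (simp only: add_eq_0_iff minus_minus)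
  moreover have "set_mset M \<subseteq> A" "set_mset N \<subseteq> B"
    unfolding M_def N_def
    by (rule subset_trans[OF set_mset_sum_replicate], rule S S', rule S S')+
  ultimately show False using sums[of M N] size \<open>M \<noteq> {#}\<close> by simp
qed

subsection \<open>Separation within an affine subspace\<close>

text \<open>Both sides are convex, hence connected, and by the intermediate value theorem a
  connected set avoiding the hyperplane stays on one side.\<close>

lemma components_affine_minus_hyperplane:
  fixes L :: "'a::euclidean_space set"
  assumes "affine L" "L \<inter> {x. a \<bullet> x < c} \<noteq> {}" "L \<inter> {x. a \<bullet> x > c} \<noteq> {}"
  shows "components (L - {x. a \<bullet> x = c}) = {L \<inter> {x. a \<bullet> x < c}, L \<inter> {x. a \<bullet> x > c}}"
    (is "components ?D = {?lt, ?gt}")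
proof -
  have conn: "connected ?lt" "connected ?gt"
    using affine_imp_convex[OF assms(1)]
    by (auto intro!: convex_connected convex_Int convex_halfspace_lt convex_halfspace_gt)
  have one_side: "D \<subseteq> ?lt \<or> D \<subseteq> ?gt" if D: "D \<subseteq> ?D" "connected D" for D
  proof (rule ccontr)
    assume "\<not> ?thesis"
    then obtain x y where xy: "x \<in> D" "x \<notin> ?lt" "y \<in> D" "y \<notin> ?gt" by blast
    with D(1) have "a \<bullet> y \<le> c" "c \<le> a \<bullet> x" by fastforce+
    then obtain z where "z \<in> D" "a \<bullet> z = c"
      using connected_ivt_hyperplane[OF D(2) xy(3,1)] by blast
    with D show False by blast
  qed
  have "?lt \<inter> ?gt = {}" by auto
  have maximal: "D = ?lt" if "D \<noteq> {}" "?lt \<subseteq> D" "D \<subseteq> ?D" "connected D" for D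
    using one_side[OF that(3,4)] that assms(2) \<open>?lt \<inter> ?gt = {}\<close> by blast
  have maximal': "D = ?gt" if "D \<noteq> {}" "?gt \<subseteq> D" "D \<subseteq> ?D" "connected D" for D
    using one_side[OF that(3,4)] that assms(3) \<open>?lt \<inter> ?gt = {}\<close> by blast
  have lt: "?lt \<in> components ?D"
    unfolding in_components_maximal
  proof (intro conjI allI impI)
    show "D = ?lt" if "D \<noteq> {} \<and> ?lt \<subseteq> D \<and> D \<subseteq> ?D \<and> connected D" for D
      using maximal that by simp
  qed (use conn assms in auto)
  have gt: "?gt \<in> components ?D"
    unfolding in_components_maximal
  proof (intro conjI allI impI)
    show "D = ?gt" if "D \<noteq> {} \<and> ?gt \<subseteq> D \<and> D \<subseteq> ?D \<and> connected D" for D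
      using maximal' that by simp
  qed (use conn assms in auto)
  have "C = ?lt \<or> C = ?gt" if C: "C \<in> components ?D" for C
  proof -
    have "C \<noteq> {}" using C by (rule in_components_nonempty)
    moreover have "C \<subseteq> ?lt \<or> C \<subseteq> ?gt"
      using in_components_subset[OF C] in_components_connected[OF C] by (rule one_side)
    ultimately have "C \<inter> ?lt \<noteq> {} \<or> C \<inter> ?gt \<noteq> {}" by blast
    then show ?thesis
      using components_nonoverlap[OF C lt] components_nonoverlap[OF C gt] by metis
  qed
  then show ?thesis using lt gt by (intro equalityI subsetI) auto
qed

text \<open>\<open>P\<close> is an intersection of hyperplanes of the whole space. One of them
  misses a point of \<open>L\<close> outside \<open>P\<close>; it cuts \<open>L\<close> in an affine
  set that contains \<open>P\<close> and has the same dimension, hence equals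
  \<open>P\<close>.\<close>

lemma hyperplane_in_obtain_normal:
  fixes L :: "(real ^ 'n) set"
  assumes "affine L" "hyperplane_in P L" "P \<noteq> {}"
  obtains a c y where "P = L \<inter> {x. a \<bullet> x = c}" "y \<in> L" "a \<bullet> y \<noteq> c"
proof -
  have P: "affine P" "P \<subseteq> L" "aff_dim P = aff_dim L - 1"
    using assms by (auto simp: hyperplane_in_def)
  then have "P \<noteq> L" by auto
  with P obtain y where y: "y \<in> L" "y \<notin> P" by blast
  obtain \<F> where "P = \<Inter>\<F>"
    and \<F>: "\<And>h. h \<in> \<F> \<Longrightarrow> \<exists>a b. a \<noteq> 0 \<and> h = {x. a \<bullet> x = b}"
    using affine_hull_finite_intersection_hyperplanes[of P] affine_hull_eq[of P] P(1) by metis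
  with y obtain h where h: "h \<in> \<F>" "y \<notin> h" "P \<subseteq> h" by blast
  then obtain a c where ac: "h = {x. a \<bullet> x = c}" using \<F> by blast
  have "P = L \<inter> h"
  proof (rule affine_dim_equal)
    show "affine (L \<inter> h)" using assms(1) ac by (simp add: affine_Int affine_hyperplane)
    have "L \<inter> h \<noteq> {}" "\<not> L \<subseteq> h" using P assms(3) y h by auto
    then show "aff_dim P = aff_dim (L \<inter> h)"
      using P ac aff_dim_affine_Int_hyperplane[OF assms(1), of a c] by simp
  qed (use P h assms in auto)
  with y h ac that show ?thesis by blast
qed

text \<open>Translates the topological definition into weak linear inequalities. The components may
  come in either order, so the sign of the normal is chosen to put \<open>A\<close> on the upper
  side.\<close>

lemma separates_in_obtain_normal:
  fixes L :: "(real ^ 'n) set"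
  assumes "affine L" "separates_in P L A B" "P \<noteq> {}" "A \<inter> B = {}"
  obtains a c where "P = L \<inter> {x. a \<bullet> x = c}"
    "\<And>x. x \<in> L \<inter> A \<Longrightarrow> a \<bullet> x \<ge> c" "\<And>x. x \<in> L \<inter> B \<Longrightarrow> a \<bullet> x \<le> c"
proof -
  have "hyperplane_in P L" using assms(2) by (simp add: separates_in_def)
  then obtain a c y where P: "P = L \<inter> {x. a \<bullet> x = c}" and y: "y \<in> L" "a \<bullet> y \<noteq> c"
    using hyperplane_in_obtain_normal assms by metis
  let ?lt = "L \<inter> {x. a \<bullet> x < c}" and ?gt = "L \<inter> {x. a \<bullet> x > c}"
  obtain p where p: "p \<in> L" "a \<bullet> p = c" using assms(3) P by blast
  \<comment> \<open>The reflection of \<open>y\<close> in the point \<open>p\<close> of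
    \<open>P\<close>: it lies in \<open>L\<close> on the other side, so both open sides are
    nonempty.\<close>
  define y' where "y' = 2 *\<^sub>R p + (- 1) *\<^sub>R y"
  have "y' \<in> L" unfolding y'_def using assms(1) p y by (intro mem_affine) auto
  moreover have "a \<bullet> y' = 2 * c - a \<bullet> y" by (simp add: y'_def p inner_diff_right)
  ultimately have "?lt \<noteq> {} \<and> ?gt \<noteq> {}" using y by (cases "a \<bullet> y < c") auto
  then have comps: "components (L - {x. a \<bullet> x = c}) = {?lt, ?gt}"
    using components_affine_minus_hyperplane assms(1) by metis
  have "L - P = L - {x. a \<bullet> x = c}" using P by blast
  with comps have comps_P: "components (L - P) = {?lt, ?gt}" by simp
  obtain Rp Rm where R: "Rp \<in> components (L - P)" "Rm \<in> components (L - P)" "Rp \<inter> Rm = {}"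
      "Rp \<inter> (A \<union> B) \<subseteq> A" "Rm \<inter> (A \<union> B) \<subseteq> B"
    using assms(2) unfolding separates_in_def by (elim conjE bexE) (rule that)
  have "Rp \<noteq> Rm" using R(1,3) in_components_nonempty by fast
  with R(1,2) have "Rp = ?gt \<and> Rm = ?lt \<or> Rp = ?lt \<and> Rm = ?gt" unfolding comps_P by auto
  then show ?thesis
  proof
    assume "Rp = ?gt \<and> Rm = ?lt"
    then have "?gt \<inter> B = {}" "?lt \<inter> A = {}" using R(4,5) assms(4) by auto
    then show ?thesis by (intro that[of a c] P) (auto simp: disjoint_iff not_less)
  next
    assume "Rp = ?lt \<and> Rm = ?gt"
    then have "?lt \<inter> B = {}" "?gt \<inter> A = {}" using R(4,5) assms(4) by auto
    then show ?thesis by (intro that[of "- a" "- c"]) (auto simp: P disjoint_iff not_less)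
  qed
qed

text \<open>The points \<open>y\<close> and \<open>z\<close> make both sides nonempty, and the
  hyperplane meets \<open>L\<close> between them, so the dimension drops by exactly 1.\<close>

lemma separates_inI:
  fixes L :: "(real ^ 'n) set"
  assumes "affine L" "y \<in> L" "a \<bullet> y < c" "z \<in> L" "a \<bullet> z > c" "A \<inter> B = {}"
    and A: "\<And>x. x \<in> L \<inter> A \<Longrightarrow> a \<bullet> x \<ge> c" and B: "\<And>x. x \<in> L \<inter> B \<Longrightarrow> a \<bullet> x \<le> c"
  shows "separates_in (L \<inter> {x. a \<bullet> x = c}) L A B"
proof -
  let ?P = "L \<inter> {x. a \<bullet> x = c}"
  let ?lt = "L \<inter> {x. a \<bullet> x < c}" and ?gt = "L \<inter> {x. a \<bullet> x > c}"
  have "L - ?P = L - {x. a \<bullet> x = c}" by blast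
  then have comps: "components (L - ?P) = {?lt, ?gt}"
    using components_affine_minus_hyperplane[of L a c] assms by auto
  obtain p where "p \<in> L" "a \<bullet> p = c"
    using connected_ivt_hyperplane[of L y z a c] assms affine_imp_convex convex_connected
    by (metis less_imp_le)
  then have "aff_dim ?P = aff_dim L - 1"
    using aff_dim_affine_Int_hyperplane[OF assms(1), of a c] assms by auto
  then have "hyperplane_in ?P L"
    using assms by (auto simp: hyperplane_in_def intro: affine_Int affine_hyperplane)
  moreover have "?gt \<inter> (A \<union> B) \<subseteq> A" "?lt \<inter> (A \<union> B) \<subseteq> B"
    using A B by force+
  moreover have "?gt \<inter> ?lt = {}" "?gt \<union> ?lt = L - ?P" by auto
  ultimately show ?thesis
    unfolding separates_in_def comps by (metis insertI1 insertI2)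
qed

text \<open>Disjoint hulls need not have positive distance, so only weak separation is sought: 0 is
  separated from the set \<open>C\<close> of differences. Taking the normal in the span of
  \<open>C\<close> makes it a direction of \<open>L\<close>, so it is not constant on
  \<open>L\<close>.\<close>

lemma ex_separating_hyperplane_in_affine:
  fixes L :: "(real ^ 'n) set"
  assumes "affine L" "A \<inter> L \<noteq> {}" "B \<inter> L \<noteq> {}"
    and hulls: "convex hull A \<inter> convex hull B = {}"
  shows "\<exists>P. separates_in P L A B"
proof -
  define C where "C = (\<Union>x\<in>convex hull (A \<inter> L). \<Union>y\<in>convex hull (B \<inter> L). {x - y})"
  have "convex C" unfolding C_def by (intro convex_differences convex_convex_hull)
  moreover have "C \<noteq> {}" using assms by (auto simp: C_def)
  moreover have "convex hull (A \<inter> L) \<subseteq> convex hull A" "convex hull (B \<inter> L) \<subseteq> convex hull B"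
    by (simp_all add: hull_mono)
  then have "0 \<notin> C" using hulls by (auto simp: C_def)
  ultimately obtain a where a: "a \<in> span C" "a \<noteq> 0" "\<And>x. x \<in> C \<Longrightarrow> 0 \<le> a \<bullet> x"
    using separating_hyperplane_set_0_inspan by blast
  obtain p where p: "p \<in> L" using assms by blast
  have V: "subspace ((\<lambda>x. x - p) ` L)"
    using affine_diffs_subspace_subtract[OF assms(1) p] .
  have hull_L: "convex hull (A \<inter> L) \<subseteq> L" "convex hull (B \<inter> L) \<subseteq> L"
    using affine_imp_convex[OF assms(1)] by (simp_all add: hull_minimal)
  have "C \<subseteq> (\<lambda>x. x - p) ` L"
  proof
    fix z assume "z \<in> C"
    then obtain x y where "x \<in> L" "y \<in> L" "z = (x - p) - (y - p)"
      using hull_L by (auto simp: C_def)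
    then show "z \<in> (\<lambda>x. x - p) ` L" using subspace_diff[OF V] by blast
  qed
  then have "a \<in> (\<lambda>x. x - p) ` L" using a(1) span_minimal[OF _ V] by blast
  then have "t *\<^sub>R a \<in> (\<lambda>x. x - p) ` L" for t by (rule subspace_scale[OF V])
  \<comment> \<open>Moving along the normal stays inside \<open>L\<close>; hence the functional
    attains every real value on \<open>L\<close>, in particular values on both sides of
    \<open>c\<close>.\<close>
  have line: "p + t *\<^sub>R a \<in> L" for t
  proof -
    obtain y where "y \<in> L" "t *\<^sub>R a = y - p"
      using \<open>\<And>t. t *\<^sub>R a \<in> (\<lambda>x. x - p) ` L\<close>[of t] by blast
    then show ?thesis by simp
  qed
  have le: "a \<bullet> y \<le> a \<bullet> x" if "x \<in> A \<inter> L" "y \<in> B \<inter> L" for x y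
  proof -
    have "x \<in> convex hull (A \<inter> L)" "y \<in> convex hull (B \<inter> L)" using that by (auto intro: hull_inc)
    then have "x - y \<in> C" by (auto simp: C_def)
    then show ?thesis using a(3)[of "x - y"] by (simp add: inner_diff_right)
  qed
  define c where "c = (SUP y\<in>B \<inter> L. a \<bullet> y)"
  have ge_c: "c \<le> a \<bullet> x" if "x \<in> A \<inter> L" for x
    unfolding c_def using le that assms(3) by (intro cSUP_least) auto
  obtain x0 where "x0 \<in> A \<inter> L" using assms by blast
  then have "bdd_above ((\<lambda>y. a \<bullet> y) ` (B \<inter> L))" using le by (intro bdd_aboveI2[of _ _ "a \<bullet> x0"]) auto
  then have le_c: "a \<bullet> y \<le> c" if "y \<in> B \<inter> L" for y
    unfolding c_def using that by (intro cSUP_upper)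
  have attained: "\<exists>y\<in>L. a \<bullet> y = r" for r
    using line[of "(r - a \<bullet> p) / (a \<bullet> a)"] a(2)
    by (intro bexI[of _ "p + ((r - a \<bullet> p) / (a \<bullet> a)) *\<^sub>R a"]) (simp_all add: inner_add_right)
  obtain y z where "y \<in> L" "a \<bullet> y = c - 1" "z \<in> L" "a \<bullet> z = c + 1"
    using attained by blast
  moreover have "A \<inter> B = {}" using hulls hull_subset[of A convex] hull_subset[of B convex] by blast
  ultimately have "separates_in (L \<inter> {x. a \<bullet> x = c}) L A B"
    using ge_c le_c by (intro separates_inI[OF assms(1), of y a c z]) auto
  then show ?thesis by blast
qed

subsection \<open>Separation by sequences of hyperplanes\<close>

lemma condition_H_imp_condition_P:
  fixes A B :: "(real ^ 'n) set"
  assumes "A \<inter> B = {}" "condition_H A B"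
  shows "condition_P A B"
proof (rule ccontr)
  assume "\<not> condition_P A B"
  then have "\<exists>a1\<in>A. \<exists>a2\<in>A. \<exists>b1\<in>B. \<exists>b2\<in>B. a1 + a2 = b1 + b2"
    using assms(1) unfolding condition_P_iff by simp
  then obtain a1 a2 b1 b2 where ab: "a1 \<in> A" "a2 \<in> A" "b1 \<in> B" "b2 \<in> B" "a1 + a2 = b1 + b2"
    by blast
  obtain k H where k: "k \<le> CARD('n)"
    and aff: "\<And>i. i \<in> {k..CARD('n)} \<Longrightarrow> affine (H i) \<and> aff_dim (H i) = int i"
    and top: "H CARD('n) = UNIV"
    and bot: "H k \<inter> (A \<union> B) \<subseteq> A \<or> H k \<inter> (A \<union> B) \<subseteq> B"
    and sep: "\<And>i. i \<in> {k+1..CARD('n)} \<Longrightarrow> separates_in (H (i - 1)) (H i) A B"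
    using assms(2) unfolding condition_H_def by (elim exE conjE, intro that) auto
  \<comment> \<open>Induction downwards from \<open>H CARD('n) = UNIV\<close>. In each step the sum
    over the \<open>A\<close> points is at least \<open>2 * c\<close> and the sum over the
    \<open>B\<close> points at most \<open>2 * c\<close>, so equality of the sums forces equality at
    all four points.\<close>
  have "{a1, a2, b1, b2} \<subseteq> H k"
    using k
  proof (induction rule: inc_induct)
    case base
    then show ?case by (simp add: top)
  next
    case (step n)
    have "H n \<noteq> {}" using aff[of n] step by (auto simp: aff_dim_empty)
    then obtain a c where P: "H n = H (Suc n) \<inter> {x. a \<bullet> x = c}"
      and A: "\<And>x. x \<in> H (Suc n) \<inter> A \<Longrightarrow> a \<bullet> x \<ge> c"
      and B: "\<And>x. x \<in> H (Suc n) \<inter> B \<Longrightarrow> a \<bullet> x \<le> c"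
      using separates_in_obtain_normal[of "H (Suc n)" "H n" A B] sep[of "Suc n"] aff[of "Suc n"]
        step assms(1) by auto
    have "a \<bullet> a1 + a \<bullet> a2 = a \<bullet> b1 + a \<bullet> b2"
      using ab(5) by (metis inner_add_right)
    moreover have "a \<bullet> a1 \<ge> c" "a \<bullet> a2 \<ge> c" "a \<bullet> b1 \<le> c" "a \<bullet> b2 \<le> c"
      using A B ab step by auto
    ultimately have "a \<bullet> a1 = c" "a \<bullet> a2 = c" "a \<bullet> b1 = c" "a \<bullet> b2 = c" by linarith+
    then show ?case using step P by auto
  qed
  with ab bot assms(1) show False by blast
qed

text \<open>Induction on the dimension, with \<open>L\<close> arbitrary so that it can be replaced
  by a separating hyperplane in it. Disjointness of the hulls concerns all of \<open>A\<close> and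
  \<open>B\<close> and so passes to every subspace; the descent stops once one set is missed, at the
  latest at a point.\<close>

lemma ex_separating_sequence:
  fixes L :: "(real ^ 'n) set"
  assumes "affine L" "aff_dim L = int i" "convex hull A \<inter> convex hull B = {}"
  shows "\<exists>k\<le>i. \<exists>H. (\<forall>j\<in>{k..i}. affine (H j) \<and> aff_dim (H j) = int j) \<and> H i = L \<and>
    (H k \<inter> (A \<union> B) \<subseteq> A \<or> H k \<inter> (A \<union> B) \<subseteq> B) \<and>
    (\<forall>j\<in>{k+1..i}. separates_in (H (j - 1)) (H j) A B)"
  using assms(1,2)
proof (induction i arbitrary: L)
  case 0
  then obtain x where "L = {x}" by (auto simp: aff_dim_eq_0)
  moreover have "A \<inter> B = {}"
    using assms(3) hull_subset[of A convex] hull_subset[of B convex] by blast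
  ultimately show ?case using 0 by (intro exI[of _ 0] conjI exI[of _ "\<lambda>_. L"]) auto
next
  case (Suc i)
  show ?case
  proof (cases "A \<inter> L = {} \<or> B \<inter> L = {}")
    case True
    then show ?thesis using Suc.prems by (intro exI[of _ "Suc i"] conjI exI[of _ "\<lambda>_. L"]) auto
  next
    case False
    then obtain P where P: "separates_in P L A B"
      using ex_separating_hyperplane_in_affine[OF Suc.prems(1)] assms(3) by blast
    then have "affine P" "aff_dim P = int i"
      using Suc.prems by (auto simp: separates_in_def hyperplane_in_def)
    from Suc.IH[OF this] obtain k H where k: "k \<le> i" "\<forall>j\<in>{k..i}. affine (H j) \<and> aff_dim (H j) = int j" "H i = P"
      "H k \<inter> (A \<union> B) \<subseteq> A \<or> H k \<inter> (A \<union> B) \<subseteq> B"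
      "\<forall>j\<in>{k+1..i}. separates_in (H (j - 1)) (H j) A B"
      by (elim exE conjE) (rule that)
    \<comment> \<open>The sequence found below \<open>P\<close> is extended by \<open>L\<close> as
      its new top member.\<close>
    define H' where "H' = H(Suc i := L)"
    have "\<forall>j\<in>{k..Suc i}. affine (H' j) \<and> aff_dim (H' j) = int j"
      using k(2) Suc.prems by (auto simp: H'_def le_Suc_eq)
    moreover have "H' k = H k" "H' (Suc i) = L" using k(1) by (auto simp: H'_def)
    moreover have "separates_in (H' (j - 1)) (H' j) A B" if j: "j \<in> {k+1..Suc i}" for j
    proof (cases "j = Suc i")
      case True
      then show ?thesis using P k(3) by (simp add: H'_def)
    next
      case False
      then have "j \<in> {k+1..i}" "j - 1 \<noteq> Suc i" using j by auto
      then show ?thesis using k(5) False by (simp add: H'_def)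
    qed
    ultimately show ?thesis using k(1,4) by (intro exI[of _ k] conjI exI[of _ H']) auto
  qed
qed

lemma condition_P_imp_condition_H:
  fixes A B :: "(real ^ 'n) set"
  assumes "A \<union> B = int_lattice" "condition_P A B"
  shows "condition_H A B"
proof -
  have disj: "A \<inter> B = {}" using assms(2) by (simp add: condition_P_iff)
  have "convex hull A \<inter> convex hull B = {}"
  proof (rule convex_hulls_disjoint_if_sum_msets_differ)
    show "\<Sum>\<^sub># M \<noteq> \<Sum>\<^sub># N"
      if "set_mset M \<subseteq> A" "set_mset N \<subseteq> B" "size M = size N" "M \<noteq> {#}" for M N
      using sum_mset_neq_if_add_diff_closed[OF disj _ that] condition_P_add_diff[OF assms] by simp
  qed (use assms disj in auto)
  moreover have "aff_dim (UNIV :: (real ^ 'n) set) = int CARD('n)" by simp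
  ultimately obtain k and H :: "nat \<Rightarrow> (real ^ 'n) set" where k: "k \<le> CARD('n)"
    and aff: "\<forall>j\<in>{k..CARD('n)}. affine (H j) \<and> aff_dim (H j) = int j"
    and top: "H CARD('n) = UNIV"
    and bot: "H k \<inter> (A \<union> B) \<subseteq> A \<or> H k \<inter> (A \<union> B) \<subseteq> B"
    and sep: "\<forall>j\<in>{k+1..CARD('n)}. separates_in (H (j - 1)) (H j) A B"
    using ex_separating_sequence[OF affine_UNIV, of "CARD('n)" A B]
    by (elim meta_impE exE conjE) (assumption, assumption, rule that)
  moreover have "\<forall>j\<in>{k+1..CARD('n)}. H (j - 1) \<subseteq> H j"
    using sep by (auto simp: separates_in_def hyperplane_in_def)
  ultimately show ?thesis
    unfolding condition_H_def by (intro exI[of _ k] conjI exI[of _ H])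
qed

subsection \<open>The ray condition\<close>

lemma line_eq_affine_hull:
  fixes L :: "'a::euclidean_space set"
  assumes "affine L" "aff_dim L = 1" "x \<in> L" "y \<in> L" "x \<noteq> y"
  shows "L = {x + t *\<^sub>R (y - x) | t. True}"
proof -
  have "affine hull {x, y} = L"
  proof (rule affine_dim_equal)
    show "affine hull {x, y} \<subseteq> L" using assms by (intro hull_minimal) auto
  qed (use assms in auto)
  then show ?thesis by (auto simp: affine_hull_2_alt)
qed

text \<open>The direction of a ray in the line is a multiple of \<open>w\<close>, and the ray never
  ends in that direction. For \<open>w = y - x\<close> the two candidates are the reflection of
  \<open>x\<close> in \<open>y\<close> and \<open>x\<close> itself.\<close>

lemma ray_contains_reflection:
  fixes L :: "(real ^ 'n) set"
  assumes "is_ray R" "R \<subseteq> {x + t *\<^sub>R w | t. True}" "y \<in> R"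
  shows "y + w \<in> R \<or> y - w \<in> R"
proof -
  obtain p v where v: "v \<noteq> 0" and R: "R = {p + t *\<^sub>R v | t. t \<ge> 0}"
    using assms(1) by (auto simp: is_ray_def)
  obtain s where s: "y = p + s *\<^sub>R v" "s \<ge> 0" using assms(3) R by blast
  have "p \<in> R" unfolding R by (auto intro!: exI[of _ 0])
  moreover have "p + v \<in> R" unfolding R by (auto intro!: exI[of _ 1])
  ultimately obtain t1 t2 where "p = x + t1 *\<^sub>R w" "p + v = x + t2 *\<^sub>R w" using assms(2) by blast
  then have v_w: "v = (t2 - t1) *\<^sub>R w" by (simp add: algebra_simps)
  with v have "t2 \<noteq> t1" by auto
  \<comment> \<open>The sign of \<open>r\<close> tells whether the ray runs along \<open>w\<close>
    or against it.\<close>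
  define r where "r = 1 / (t2 - t1)"
  have w: "w = r *\<^sub>R v" using v_w \<open>t2 \<noteq> t1\<close> by (simp add: r_def)
  show ?thesis
  proof (cases "r \<ge> 0")
    case True
    then have "y + w \<in> R" unfolding R using s w
      by (auto intro!: exI[of _ "s + r"] simp: algebra_simps)
    then show ?thesis ..
  next
    case False
    then have "y - w \<in> R" unfolding R using s w
      by (auto intro!: exI[of _ "s - r"] simp: algebra_simps)
    then show ?thesis ..
  qed
qed

lemma convex_ray:
  assumes "is_ray R"
  shows "convex R"
proof -
  obtain x v where "R = (\<lambda>t. x + t *\<^sub>R v) ` {0..}"
    using assms by (auto simp: is_ray_def)
  moreover have "(\<lambda>t. x + t *\<^sub>R v) ` {0..} = (+) x ` (\<lambda>t. t *\<^sub>R v) ` {0::real..}"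
    by (simp add: image_image)
  moreover have "convex ((\<lambda>t. t *\<^sub>R v) ` {0::real..})"
    by (intro convex_linear_image) (auto intro: linearI simp: scaleR_left_distrib)
  ultimately show ?thesis by (simp add: convex_translation)
qed

text \<open>Condition R supplies a ray for \<open>A\<close> only, so the two claims have different
  reasons: the first rests on the convexity of the ray, the second on its being unbounded.\<close>

lemma condition_R_reflect:
  fixes A B :: "(real ^ 'n) set"
  assumes "A \<union> B = int_lattice" "A \<inter> B = {}" "condition_R A B"
  shows "x \<in> A \<Longrightarrow> y \<in> B \<Longrightarrow> y + (y - x) \<in> B"
    and "x \<in> B \<Longrightarrow> y \<in> A \<Longrightarrow> y + (y - x) \<in> A"
proof -
  have line: "\<exists>R. is_ray R \<and> R \<subseteq> {x + t *\<^sub>R (y - x) | t. True} \<and>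
      A \<inter> {x + t *\<^sub>R (y - x) | t. True} = R \<inter> (A \<union> B)"
    if xy: "x \<in> A \<and> y \<in> B \<or> x \<in> B \<and> y \<in> A" for x y
  proof -
    let ?L = "affine hull {x, y}"
    have "x \<noteq> y" using xy assms(2) by blast
    then have "affine ?L" "aff_dim ?L = 1" "x \<in> ?L" "y \<in> ?L" by (auto simp: hull_inc)
    moreover from this \<open>x \<noteq> y\<close> have "?L = {x + t *\<^sub>R (y - x) | t. True}"
      by (rule line_eq_affine_hull)
    moreover have "A \<inter> ?L \<noteq> {}" "B \<inter> ?L \<noteq> {}" using xy \<open>x \<in> ?L\<close> \<open>y \<in> ?L\<close> by blast+
    ultimately show ?thesis using assms(3) unfolding condition_R_def by metis
  qed
  have in_line: "x + t *\<^sub>R (y - x) \<in> {x + t *\<^sub>R (y - x) | t. True}" for x y :: "real ^ 'n" and t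
    by blast
  have pts: "x \<in> {x + t *\<^sub>R (y - x) | t. True}" "y \<in> {x + t *\<^sub>R (y - x) | t. True}"
      "y + (y - x) \<in> {x + t *\<^sub>R (y - x) | t. True}" for x y :: "real ^ 'n"
    using in_line[of x 0 y] in_line[of x 1 y] in_line[of x 2 y] by (simp_all add: scaleR_2)
  have lattice: "y + (y - x) \<in> A \<union> B" if "x \<in> A \<union> B" "y \<in> A \<union> B" for x y
    using that int_lattice_add int_lattice_diff assms(1) by metis
  show "y + (y - x) \<in> B" if xy: "x \<in> A" "y \<in> B"
  proof (rule ccontr)
    assume "y + (y - x) \<notin> B"
    then have z: "y + (y - x) \<in> A" using lattice[of x y] xy by blast
    obtain R where R: "is_ray R" "A \<inter> {x + t *\<^sub>R (y - x) | t. True} = R \<inter> (A \<union> B)"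
      using line[of x y] xy by blast
    have "x \<in> R" "y + (y - x) \<in> R" using R(2) z xy pts by blast+
    \<comment> \<open>The point \<open>y\<close> of \<open>B\<close> is the midpoint of two points
      of the ray, hence on it.\<close>
    then have "(1/2) *\<^sub>R x + (1/2) *\<^sub>R (y + (y - x)) \<in> R"
      using convexD[OF convex_ray[OF R(1)]] by simp
    moreover have "(1/2) *\<^sub>R x + (1/2) *\<^sub>R (y + (y - x)) = y"
      by (simp add: vec_eq_iff field_simps)
    ultimately have "y \<in> A" using R(2) xy by auto
    then show False using xy assms(2) by blast
  qed
  show "y + (y - x) \<in> A" if xy: "x \<in> B" "y \<in> A"
  proof -
    obtain R where R: "is_ray R" "R \<subseteq> {x + t *\<^sub>R (y - x) | t. True}"
      "A \<inter> {x + t *\<^sub>R (y - x) | t. True} = R \<inter> (A \<union> B)"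
      using line[of x y] xy by blast
    have "y \<in> R" using R(3) xy pts by blast
    moreover have "x \<notin> R" using R(3) xy assms(2) by blast
    ultimately have "y + (y - x) \<in> R" using ray_contains_reflection[OF R(1,2)] by fastforce
    then show ?thesis using lattice[of x y] xy R(3) by blast
  qed
qed

lemma condition_R_imp_condition_P:
  fixes A B :: "(real ^ 'n) set"
  assumes "A \<union> B = int_lattice" "A \<inter> B = {}" "condition_R A B"
  shows "condition_P A B"
proof -
  have False if ab: "a1 \<in> A" "a2 \<in> A" "b1 \<in> B" "b2 \<in> B" "a1 + a2 = b1 + b2" for a1 a2 b1 b2
  proof -
    txt \<open>\<open>a2\<close> is the midpoint of the reflections of \<open>a1\<close> in \<open>b1\<close> and in \<open>b2\<close>.\<close>
    have refl: "b1 + (b1 - a1) \<in> B" "b2 + (b2 - a1) \<in> B"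
      using condition_R_reflect(1)[OF assms] ab by auto
    have "a2 + (a2 - (b1 + (b1 - a1))) \<in> A"
      using condition_R_reflect(2)[OF assms refl(1) ab(2)] .
    moreover have "a2 = b1 + b2 - a1" using ab(5) by (simp add: algebra_simps)
    ultimately have "b2 + (b2 - a1) \<in> A" by simp
    then show False using refl(2) assms(2) by auto
  qed
  then show ?thesis using assms(2) unfolding condition_P_iff by blast
qed

section \<open>Half-infinite intervals of integers and lattice points on a line\<close>

lemma int_set_no_down_step_imp_interval:
  fixes T :: "int set"
  assumes "T \<noteq> {}" "T \<noteq> UNIV" "\<And>n. n + 1 \<in> T \<Longrightarrow> n \<in> T"
  shows "\<exists>n. T = {..n}"
proof -
  have down: "m \<in> T" if "m \<le> n" "n \<in> T" for m n
    using that by (induction rule: int_le_induct) (use assms(3) in force)+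
  have "\<exists>n. n \<in> T \<and> n + 1 \<notin> T"
  proof (rule ccontr)
    assume "\<not> ?thesis"
    then have up: "n + 1 \<in> T" if "n \<in> T" for n using that by blast
    obtain m where "m \<in> T" using assms(1) by blast
    have "k \<in> T" for k
    proof (cases "m \<le> k")
      case True
      then show ?thesis by (induction rule: int_ge_induct) (use up \<open>m \<in> T\<close> in auto)
    next
      case False
      then show ?thesis using down[of k m] \<open>m \<in> T\<close> by simp
    qed
    then show False using assms(2) by blast
  qed
  then obtain n where n: "n \<in> T" "n + 1 \<notin> T" by blast
  have "m \<le> n" if "m \<in> T" for m
    using n(2) down[of "n + 1" m] that by linarith
  then have "T \<subseteq> {..n}" by blast
  moreover have "{..n} \<subseteq> T" using down[OF _ n(1)] by blast
  ultimately have "T = {..n}" by (rule equalityI)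
  then show ?thesis ..
qed

text \<open>If \<open>n + 1\<close> is in \<open>T\<close> but \<open>n\<close> is not, the identity
  \<open>(n + 1) + m = n + (m + 1)\<close> shows that \<open>T\<close> is closed under successors.
  If there is no such \<open>n\<close>, then \<open>T\<close> is closed under predecessors.\<close>

lemma int_set_parallelogram_imp_interval:
  fixes T :: "int set"
  assumes "T \<noteq> {}" "T \<noteq> UNIV"
    and P: "\<And>i j k l. i \<in> T \<Longrightarrow> j \<in> T \<Longrightarrow> k \<notin> T \<Longrightarrow> l \<notin> T \<Longrightarrow> i + j \<noteq> k + l"
  shows "\<exists>n. T = {..n} \<or> T = {n..}"
proof (cases "\<exists>n. n + 1 \<in> T \<and> n \<notin> T")
  case True
  then obtain n where n: "n + 1 \<in> T" "n \<notin> T" by blast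
  have up: "m + 1 \<in> T" if "m \<in> T" for m
    using P[OF n(1) that n(2), of "m + 1"] by auto
  \<comment> \<open>Negation turns closure under successors into closure under predecessors.\<close>
  have "\<exists>k. uminus ` T = {..k}"
  proof (rule int_set_no_down_step_imp_interval)
    show "uminus ` T \<noteq> UNIV"
      using n(2) by (metis UNIV_I image_iff minus_equation_iff)
    show "m \<in> uminus ` T" if m: "m + 1 \<in> uminus ` T" for m
    proof -
      obtain i where "i \<in> T" "m + 1 = - i" using m by blast
      then have "i + 1 \<in> T" "m = - (i + 1)" using up by auto
      then show ?thesis by blast
    qed
  qed (use assms in auto)
  then obtain k where "uminus ` T = {..k}" by blast
  then have "uminus ` uminus ` T = {- k..}" by simp
  then have "T = {- k..}" by (simp add: image_image)
  then show ?thesis by blast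
next
  case False
  then show ?thesis using int_set_no_down_step_imp_interval[of T] assms by blast
qed

text \<open>A coordinate \<open>i\<close> in which \<open>a\<close> and \<open>b\<close> differ is
  injective on \<open>L\<close>. The step \<open>v\<close> leads to a lattice point of
  \<open>L\<close> whose \<open>i\<close>-th coordinate exceeds that of \<open>a\<close> by the
  least positive amount; division with remainder shows that its multiples reach all lattice points
  of \<open>L\<close>.\<close>

lemma int_lattice_line_progression:
  fixes L :: "(real ^ 'n) set"
  assumes "affine L" "aff_dim L = 1" "a \<in> L \<inter> int_lattice" "b \<in> L \<inter> int_lattice" "a \<noteq> b"
  obtains v where "v \<noteq> 0" "L = {a + t *\<^sub>R v | t. True}"
    "L \<inter> int_lattice = range (\<lambda>n::int. a + of_int n *\<^sub>R v)"
proof -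
  have L: "L = {a + t *\<^sub>R (b - a) | t. True}"
    using line_eq_affine_hull assms by blast
  obtain i where i: "b $ i \<noteq> a $ i" using assms(5) by (metis vec_eq_iff)
  have coord: "x = y" if "x \<in> L" "y \<in> L" "x $ i = y $ i" for x y
    using that i by (auto simp: L)
  define D where "D = {m::nat. m > 0 \<and> (\<exists>x \<in> L \<inter> int_lattice. x $ i - a $ i = of_nat m)}"
  have "D \<noteq> {}"
  proof -
    \<comment> \<open>If \<open>b\<close> lies below \<open>a\<close> in coordinate
      \<open>i\<close>, its reflection in \<open>a\<close> lies above.\<close>
    define b' where "b' = (if b $ i > a $ i then b else a + (a - b))"
    have "a + (-1) *\<^sub>R (b - a) \<in> L" unfolding L by blast
    moreover have "a + (a - b) \<in> int_lattice"
      using assms by (intro int_lattice_add int_lattice_diff) auto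
    ultimately have "b' \<in> L \<inter> int_lattice" "b' $ i > a $ i"
      using assms i by (auto simp: b'_def)
    moreover from this assms have "b' $ i - a $ i \<in> \<int>"
      by (auto simp: int_lattice_def)
    then obtain z where "b' $ i - a $ i = of_int z" by (auto elim: Ints_cases)
    ultimately have "nat z \<in> D" by (auto simp: D_def intro!: bexI[of _ b'])
    then show ?thesis by blast
  qed
  define g where "g = (LEAST m. m \<in> D)"
  have "g \<in> D" using \<open>D \<noteq> {}\<close> unfolding g_def by (metis LeastI ex_in_conv)
  have g_le: "g \<le> m" if "m \<in> D" for m using that unfolding g_def by (rule Least_le)
  obtain x0 where x0: "x0 \<in> L" "x0 \<in> int_lattice" "x0 $ i - a $ i = of_nat g" and "g > 0"
    using \<open>g \<in> D\<close> by (auto simp: D_def)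
  define v where "v = x0 - a"
  have vi: "v $ i = of_nat g" using x0 by (simp add: v_def)
  have v: "v \<noteq> 0" "v \<in> int_lattice"
    using x0 \<open>g > 0\<close> assms by (auto simp: v_def intro: int_lattice_diff)
  have Lv: "L = {a + t *\<^sub>R v | t. True}"
    unfolding v_def using line_eq_affine_hull[OF assms(1,2), of a x0] assms v x0
    by (auto simp: v_def)
  have "x \<in> range (\<lambda>n::int. a + of_int n *\<^sub>R v)" if x: "x \<in> L" "x \<in> int_lattice" for x
  proof -
    have "x $ i - a $ i \<in> \<int>" using x assms by (auto simp: int_lattice_def)
    then obtain m where m: "x $ i - a $ i = of_int m" by (auto elim: Ints_cases)
    \<comment> \<open>Subtracting \<open>n\<close> steps leaves a lattice point of \<open>L\<close>
      at coordinate offset \<open>m mod int g\<close>, which is less than \<open>g\<close> and so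
      must vanish by minimality.\<close>
    define n where "n = m div int g"
    define y where "y = x - of_int n *\<^sub>R v"
    obtain t where "x = a + t *\<^sub>R v" using x Lv by blast
    then have "y = a + (t - of_int n) *\<^sub>R v" by (simp add: y_def algebra_simps)
    then have "y \<in> L" using Lv by blast
    have "y \<in> int_lattice"
      unfolding y_def by (intro int_lattice_diff int_lattice_scaleR_int x v)
    have "m mod int g = m - n * int g" by (simp add: n_def minus_div_mult_eq_mod)
    then have yi: "y $ i - a $ i = of_int (m mod int g)"
      using m vi by (simp add: y_def)
    have "m mod int g = 0"
    proof (rule ccontr)
      assume "m mod int g \<noteq> 0"
      moreover have "m mod int g \<ge> 0" "m mod int g < int g" using \<open>g > 0\<close> by simp_all
      ultimately have "nat (m mod int g) \<in> D"
        using yi \<open>y \<in> L\<close> \<open>y \<in> int_lattice\<close> by (auto simp: D_def intro!: bexI[of _ y])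
      then show False using g_le \<open>m mod int g < int g\<close> \<open>m mod int g \<ge> 0\<close> by fastforce
    qed
    then have "y = a" using coord \<open>y \<in> L\<close> assms yi by auto
    then show ?thesis by (auto simp: y_def algebra_simps)
  qed
  moreover have "a + of_int n *\<^sub>R v \<in> L \<inter> int_lattice" for n
    using assms v Lv by (auto intro: int_lattice_add int_lattice_scaleR_int)
  ultimately have "L \<inter> int_lattice = range (\<lambda>n::int. a + of_int n *\<^sub>R v)" by blast
  with v Lv that show ?thesis by blast
qed

text \<open>Indexing the lattice points of the line by integers turns P into the parallelogram
  property of an index set. The resulting half-infinite interval gives the ray, starting at its
  extreme point.\<close>

lemma condition_P_imp_condition_R:
  fixes A B :: "(real ^ 'n) set"
  assumes "A \<union> B = int_lattice" "condition_P A B"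
  shows "condition_R A B"
  unfolding condition_R_def
proof (intro allI impI, elim conjE)
  fix L :: "(real ^ 'n) set"
  assume L: "affine L" "aff_dim L = 1" and ne: "A \<inter> L \<noteq> {}" "B \<inter> L \<noteq> {}"
  have disj: "A \<inter> B = {}"
    and P: "\<And>a1 a2 b1 b2. a1 \<in> A \<Longrightarrow> a2 \<in> A \<Longrightarrow> b1 \<in> B \<Longrightarrow> b2 \<in> B \<Longrightarrow> a1 + a2 \<noteq> b1 + b2"
    using assms(2) unfolding condition_P_iff by blast+
  obtain a b where ab: "a \<in> A \<inter> L" "b \<in> B \<inter> L" using ne by blast
  then have "a \<in> L \<inter> int_lattice" "b \<in> L \<inter> int_lattice" "a \<noteq> b" using disj assms(1) by auto
  with L obtain v where v: "v \<noteq> 0" "L = {a + t *\<^sub>R v | t. True}"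
    and lat: "L \<inter> int_lattice = range (\<lambda>n::int. a + of_int n *\<^sub>R v)"
    using int_lattice_line_progression by blast
  define pt where "pt n = a + of_int n *\<^sub>R v" for n :: int
  have pt_L: "pt n \<in> L" and pt_AB: "pt n \<in> A \<union> B" for n
    using lat assms(1) by (auto simp: pt_def)
  define T where "T = {n. pt n \<in> A}"
  have "\<exists>n. T = {..n} \<or> T = {n..}"
  proof (rule int_set_parallelogram_imp_interval)
    have "pt 0 \<in> A" using ab by (simp add: pt_def)
    then show "T \<noteq> {}" by (auto simp: T_def)
    obtain m where "b = pt m"
      using ab lat assms(1) unfolding pt_def by blast
    then have "m \<notin> T" using ab disj by (auto simp: T_def)
    then show "T \<noteq> UNIV" by blast
    show "i + j \<noteq> k + l" if T: "i \<in> T" "j \<in> T" "k \<notin> T" "l \<notin> T" for i j k l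
    proof
      assume "i + j = k + l"
      then have "real_of_int i + real_of_int j = real_of_int k + real_of_int l"
        by (metis of_int_add)
      then have "pt i + pt j = pt k + pt l"
        by (simp add: pt_def algebra_simps flip: scaleR_left_distrib)
      moreover have "pt i \<in> A" "pt j \<in> A" "pt k \<in> B" "pt l \<in> B"
        using T pt_AB by (auto simp: T_def)
      ultimately show False using P by blast
    qed
  qed
  \<comment> \<open>The direction \<open>u\<close> points into the interval: \<open>- v\<close> if
    it is unbounded below, \<open>v\<close> if it is unbounded above.\<close>
  then obtain n u where u: "u \<noteq> 0" "\<And>m. m \<in> T \<longleftrightarrow> (\<exists>t\<ge>0. pt m = pt n + t *\<^sub>R u)"
    and "u = v \<or> u = - v"
  proof (elim exE disjE)
    fix n assume T: "T = {..n}"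
    have "m \<in> T \<longleftrightarrow> (\<exists>t\<ge>0. pt m = pt n + t *\<^sub>R (- v))" for m
    proof
      assume "m \<in> T"
      then show "\<exists>t\<ge>0. pt m = pt n + t *\<^sub>R (- v)"
        using T by (intro exI[of _ "of_int (n - m)"]) (simp add: pt_def algebra_simps)
    next
      assume "\<exists>t\<ge>0. pt m = pt n + t *\<^sub>R (- v)"
      then obtain t where "t \<ge> 0" "(of_int m - of_int n + t) *\<^sub>R v = 0"
        by (auto simp: pt_def algebra_simps)
      then show "m \<in> T" using v(1) T by auto
    qed
    from that[OF _ this] v(1) show thesis by simp
  next
    fix n assume T: "T = {n..}"
    have "m \<in> T \<longleftrightarrow> (\<exists>t\<ge>0. pt m = pt n + t *\<^sub>R v)" for m
    proof
      assume "m \<in> T"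
      then show "\<exists>t\<ge>0. pt m = pt n + t *\<^sub>R v"
        using T by (intro exI[of _ "of_int (m - n)"]) (simp add: pt_def algebra_simps)
    next
      assume "\<exists>t\<ge>0. pt m = pt n + t *\<^sub>R v"
      then obtain t where "t \<ge> 0" "(of_int m - of_int n - t) *\<^sub>R v = 0"
        by (auto simp: pt_def algebra_simps)
      then show "m \<in> T" using v(1) T by auto
    qed
    from that[OF _ this] v(1) show thesis by simp
  qed
  define R where "R = {pt n + t *\<^sub>R u | t. t \<ge> 0}"
  have "is_ray R" using u(1) by (auto simp: R_def is_ray_def)
  moreover have "R \<subseteq> L"
  proof
    fix x assume "x \<in> R"
    then obtain t where "x = pt n + t *\<^sub>R u" by (auto simp: R_def)
    then have "x = a + (of_int n + t) *\<^sub>R v \<or> x = a + (of_int n - t) *\<^sub>R v"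
      using \<open>u = v \<or> u = - v\<close> by (auto simp: pt_def algebra_simps)
    then show "x \<in> L" using v(2) by blast
  qed
  moreover have "A \<inter> L = R \<inter> (A \<union> B)"
  proof -
    have pt_iff: "pt m \<in> A \<longleftrightarrow> pt m \<in> R" for m using u(2)[of m] by (auto simp: T_def R_def)
    have "L \<inter> (A \<union> B) = range pt" using lat assms(1) by (simp add: pt_def)
    then have "x \<in> A \<longleftrightarrow> x \<in> R" if "x \<in> L \<inter> (A \<union> B)" for x
      using that pt_iff by (metis imageE)
    then show ?thesis using \<open>R \<subseteq> L\<close> by (intro set_eqI) (metis IntD1 IntD2 IntI UnI1 subsetD)
  qed
  ultimately show "\<exists>R. is_ray R \<and> R \<subseteq> L \<and> A \<inter> L = R \<inter> (A \<union> B)" by blast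
qed

theorem theorem3p1:
  fixes A B :: "(real ^ 'n) set"
  assumes "A \<subseteq> int_lattice"
    and "B = int_lattice - A"
    and "A \<noteq> {}"
    and "B \<noteq> {}"
  shows "(condition_H A B \<longleftrightarrow> condition_R A B) \<and> (condition_R A B \<longleftrightarrow> condition_P A B)"
proof -
  have "A \<union> B = int_lattice" "A \<inter> B = {}" using assms by auto
  \<comment> \<open>Condition P is the hub: H and R are each equivalent to it.\<close>
  then show ?thesis
    using condition_H_imp_condition_P condition_P_imp_condition_H
      condition_R_imp_condition_P condition_P_imp_condition_R by metis
qed

end
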